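(* Let $1\le p<\infty$ and let $v$ be a weight on $Y$ such that $v$ coincides with $h^*_{\mathcal R}$ for some measurable function $h$ defined on $X$. Then $\|\cdot\|_{\Lambda^p_{\mathcal R}(v)}$ is a norm if, for all measurable functions $f$ on $X$, the equality $$\sup_{\{h:\,h^*_{\mathcal R}=v\}}\int_X |f(x)\,h(x)|\,d\mu(x)=\int_Y f^*_{\mathcal R}(y)\,v(y)\,d\nu(y)$$ holds.
   Context: $(X,\Sigma_X,\mu)$ and $(Y,\Sigma_Y,\nu)$ are $\sigma$-finite measure spaces and $\mathcal R:\Sigma_X\to\Sigma_Y$ is a set transformation with $\nu(\mathcal R(\emptyset))=0$. For a $\mu$-measurable function $f$ on $X$, its rearrangement is $f^*_{\mathcal R}(y)=\int_0^\infty \chi_{\mathcal R(\{x\in X:|f(x)|>t\})}(y)\,dt$, $y\in Y$ (whenever this defines a $\nu$-measurable function). $\mathcal R$ is assumed to satisfy the Fatou property: for every increasing sequence of non-negative measurable functions $f_n$ on $X$ converging to $f$ $\mu$-a.e., $(f_n)^*_{\mathcal R}$ converges increasingly to $f^*_{\mathcal R}$ $\nu$-a.e. A weight on $Y$ is a function $v\in L^1_{\mathrm{loc}}(Y,d\nu)$ (i.e. integrable over sets of finite $\nu$-measure), $v\ge 0$, such that $\mu(A)>0$ implies $\int_{\mathcal R(A)}v\,d\nu>0$ for $A\in\Sigma_X$. The Lorentz space $\Lambda^p_{\mathcal R}(v)$ consists of the $\mu$-measurable $f$ on $X$ (modulo $\mu$-a.e. equality) for which $$\|f\|_{\Lambda^p_{\mathcal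 R}(v)}=\Bigl(\int_Y (f^*_{\mathcal R}(y))^p\,v(y)\,d\nu(y)\Bigr)^{1/p}$$ is finite. Equality $h^*_{\mathcal R}=v$ is $\nu$-a.e. *)

theory Defs
  imports "HOL-Analysis.Analysis"
begin

text \<open>Scalar functions take values in a type of class \<open>real_normed_field\<close>, so that real- and
  complex-valued functions are both covered. Since \<open>f\<^sup>*\<close> may take the value \<open>\<infinity>\<close>, rearrangements
  are \<open>ennreal\<close>-valued.\<close>

definition set_transformation :: "'a measure \<Rightarrow> 'b measure \<Rightarrow> ('a set \<Rightarrow> 'b set) \<Rightarrow> bool" where
  "set_transformation M N R \<longleftrightarrow> R \<in> sets M \<rightarrow> sets N \<and> emeasure N (R {}) = 0"

definition rearrangement ::
    "'a measure \<Rightarrow> ('a set \<Rightarrow> 'b set) \<Rightarrow> ('a \<Rightarrow> 'k::real_normed_vector) \<Rightarrow> 'b \<Rightarrow> ennreal" where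
  "rearrangement M R f y =
     (\<integral>\<^sup>+ t\<in>{0<..}. indicator (R {x \<in> space M. norm (f x) > t}) y \<partial>lborel)"

text \<open>No separate hypothesis says that rearrangements are measurable: rearrangements of simple
  functions are measurable up to a null set, and by the Fatou property so is the rearrangement of
  every measurable function.\<close>

definition fatou_property :: "'a measure \<Rightarrow> 'b measure \<Rightarrow> ('a set \<Rightarrow> 'b set) \<Rightarrow> bool" where
  "fatou_property M N R \<longleftrightarrow>
     (\<forall>(F :: nat \<Rightarrow> 'a \<Rightarrow> real) f.
        (\<forall>n. F n \<in> borel_measurable M) \<longrightarrow> f \<in> borel_measurable M \<longrightarrow>
        (\<forall>x\<in>space M. (\<forall>n. 0 \<le> F n x) \<and> incseq (\<lambda>n. F n x)) \<longrightarrow>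
        (AE x in M. (\<lambda>n. F n x) \<longlonglongrightarrow> f x) \<longrightarrow>
        (AE y in N. incseq (\<lambda>n. rearrangement M R (F n) y) \<and>
                    (\<lambda>n. rearrangement M R (F n) y) \<longlonglongrightarrow> rearrangement M R f y))"

definition weight ::
    "'a measure \<Rightarrow> 'b measure \<Rightarrow> ('a set \<Rightarrow> 'b set) \<Rightarrow> ('b \<Rightarrow> real) \<Rightarrow> bool" where
  "weight M N R v \<longleftrightarrow>
     v \<in> borel_measurable N \<and> (AE y in N. 0 \<le> v y) \<and>
     (\<forall>B\<in>sets N. emeasure N B < \<infinity> \<longrightarrow> set_integrable N B v) \<and>
     (\<forall>A\<in>sets M. 0 < emeasure M A \<longrightarrow> 0 < (\<integral>\<^sup>+ y\<in>R A. ennreal (v y) \<partial>N))"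

text \<open>Real powers on \<open>[0,\<infinity>]\<close>, intended for positive exponents only.\<close>

definition ennreal_powr :: "ennreal \<Rightarrow> real \<Rightarrow> ennreal" where
  "ennreal_powr x p = (if x = \<infinity> then \<infinity> else ennreal (enn2real x powr p))"

definition lorentz_norm ::
    "'a measure \<Rightarrow> 'b measure \<Rightarrow> ('a set \<Rightarrow> 'b set) \<Rightarrow> real \<Rightarrow> ('b \<Rightarrow> real) \<Rightarrow>
     ('a \<Rightarrow> 'k::real_normed_vector) \<Rightarrow> ennreal" where
  "lorentz_norm M N R p v f =
     ennreal_powr (\<integral>\<^sup>+ y. ennreal_powr (rearrangement M R f y) p * ennreal (v y) \<partial>N) (1 / p)"

definition lorentz_space ::
    "'a measure \<Rightarrow> 'b measure \<Rightarrow> ('a set \<Rightarrow> 'b set) \<Rightarrow> real \<Rightarrow> ('b \<Rightarrow> real) \<Rightarrow>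
     ('a \<Rightarrow> 'k::real_normed_vector) set" where
  "lorentz_space M N R p v = {f \<in> borel_measurable M. lorentz_norm M N R p v f < \<infinity>}"

text \<open>\<open>V\<close> is a set of representatives: the predicate says that \<open>V\<close> modulo a.e. equality is a
  vector space of classes of measurable functions, that \<open>\<nu>\<close> is well defined on classes, and that
  it is a norm there.\<close>

definition norm_modulo_AE ::
    "'a measure \<Rightarrow> ('a \<Rightarrow> 'k::real_normed_field) set \<Rightarrow> (('a \<Rightarrow> 'k) \<Rightarrow> real) \<Rightarrow> bool" where
  "norm_modulo_AE M V \<nu> \<longleftrightarrow>
     V \<subseteq> borel_measurable M \<and>
     (\<lambda>x. 0) \<in> V \<and>
     (\<forall>f\<in>V. \<forall>g\<in>V. (\<lambda>x. f x + g x) \<in> V) \<and>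
     (\<forall>c. \<forall>f\<in>V. (\<lambda>x. c * f x) \<in> V) \<and>
     (\<forall>f\<in>V. \<forall>g\<in>borel_measurable M. (AE x in M. f x = g x) \<longrightarrow> g \<in> V \<and> \<nu> g = \<nu> f) \<and>
     (\<forall>f\<in>V. 0 \<le> \<nu> f) \<and>
     (\<forall>f\<in>V. \<nu> f = 0 \<longleftrightarrow> (AE x in M. f x = 0)) \<and>
     (\<forall>c. \<forall>f\<in>V. \<nu> (\<lambda>x. c * f x) = norm c * \<nu> f) \<and>
     (\<forall>f\<in>V. \<forall>g\<in>V. \<nu> (\<lambda>x. f x + g x) \<le> \<nu> f + \<nu> g)"

end

theory Submission
  imports Defs
begin

text \<open>
  Rearranging commutes with positive powers: \<open>(|f|\<^sup>p)\<^sup>* = (f\<^sup>*)\<^sup>p\<close> almost everywhere, since passing from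
  \<open>|f|\<close> to \<open>|f|\<^sup>p\<close> only relabels the level sets that the rearrangement is built from. This is
  \<open>rearrangement_powr\<close>. Applying the assumed duality formula to \<open>|f|\<^sup>p\<close>, instead of to \<open>f\<close>, therefore
  turns the \<open>p\<close>-th power of the Lorentz functional into
  \<open>\<integral> (f\<^sup>*)\<^sup>p v d\<nu> = sup\<^sub>h \<integral> |f|\<^sup>p |h| d\<mu>\<close>, where \<open>h\<close> runs over the functions with \<open>h\<^sup>* = v\<close>.
  So the Lorentz functional is a supremum of the seminorms of the weighted spaces
  \<open>L\<^sup>p(|h| d\<mu>)\<close>, which is again homogeneous and subadditive and is invariant under a.e. equality
  (\<open>norm_modulo_AE_power_sup\<close>). It separates points because \<open>v\<close> is a weight: for
  a set \<open>A\<close> of positive measure, \<open>sup\<^sub>h \<integral>\<^sub>A |h| d\<mu> = \<integral>\<^bsub>R(A)\<^esub> v d\<nu> > 0\<close>, so some \<open>h\<close> does not vanish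
  a.e. on the set where \<open>f\<close> is non-zero.

  The commutation with powers needs care. For a fixed \<open>y\<close> the set \<open>{t. y \<in> R {|f| > t}}\<close> should be an
  initial segment of the half-line, with \<open>f\<^sup>*(y)\<close> as its length. But \<open>R\<close> is monotone only up to null sets,
  and uncountably many pairs of levels \<open>t\<close> give uncountably many exceptional null sets. The
  claim is thus proved first for functions with countably many level sets and then carried
  over to all measurable functions by dyadic approximation and the Fatou property.
\<close>

section \<open>Powers of extended non-negative numbers\<close>

lemma ennreal_powr_ennreal [simp]: "0 \<le> c \<Longrightarrow> ennreal_powr (ennreal c) p = ennreal (c powr p)"
  by (simp add: ennreal_powr_def)

lemma ennreal_powr_0 [simp]: "ennreal_powr 0 p = 0"
  by (simp add: ennreal_powr_def)

lemma ennreal_powr_top [simp]: "ennreal_powr top p = top"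
  by (simp add: ennreal_powr_def)

lemma ennreal_powr_eq_0_iff [simp]: "ennreal_powr x p = 0 \<longleftrightarrow> x = 0"
  by (cases x) (auto simp: ennreal_eq_0_iff powr_nonneg_iff)

lemma ennreal_powr_root_le_iff:
  assumes "0 < p" "0 \<le> c"
  shows "ennreal_powr x (1 / p) \<le> ennreal c \<longleftrightarrow> x \<le> ennreal (c powr p)"
proof (cases x)
  case (real r)
  have "r powr (1 / p) \<le> c \<longleftrightarrow> (r powr (1 / p)) powr p \<le> c powr p"
    using assms by (meson not_le powr_ge_zero powr_less_mono2 powr_mono2 order_less_imp_le)
  then show ?thesis
    using real assms by (simp add: powr_powr)
qed (simp add: top_unique)

lemma ennreal_powr_root_mult:
  assumes "0 < p" "0 \<le> c"
  shows "ennreal_powr (ennreal (c powr p) * x) (1 / p) = ennreal c * ennreal_powr x (1 / p)"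
proof (cases x)
  case (real r)
  then show ?thesis
    using assms by (simp add: ennreal_mult[symmetric] powr_mult powr_powr)
next
  case top
  show ?thesis
  proof (cases "c = 0")
    case False
    then show ?thesis
      using top assms by (simp add: ennreal_mult_top)
  qed simp
qed

text \<open>Monotonicity of the sequence bounds all terms by the limit; if the limit is finite, the whole
  computation takes place in the reals.\<close>

lemma tendsto_ennreal_powr:
  assumes "0 < p" "incseq X" "X \<longlonglongrightarrow> x"
  shows "(\<lambda>n. ennreal_powr (X n) p) \<longlonglongrightarrow> ennreal_powr x p"
proof (cases x)
  case (real r)
  have "X n \<le> x" for n
    using assms(2,3) by (rule incseq_le)
  then have fin: "X n \<noteq> top" for n
    using real by (metis ennreal_neq_top top_unique)
  have "(\<lambda>n. enn2real (X n)) \<longlonglongrightarrow> r"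
    using assms(3) real by (intro tendsto_enn2real) auto
  then have "(\<lambda>n. ennreal (enn2real (X n) powr p)) \<longlonglongrightarrow> ennreal (r powr p)"
    using assms(1) by (intro tendsto_ennrealI tendsto_powr') auto
  then show ?thesis
    using fin real by (simp add: ennreal_powr_def)
next
  case top
  have "\<forall>\<^sub>F n in sequentially. ennreal l < ennreal_powr (X n) p" if "0 \<le> l" for l
  proof -
    have "\<forall>\<^sub>F n in sequentially. ennreal (l powr (1 / p)) < X n"
      using assms(3) top order_tendstoD(1) by fastforce
    then show ?thesis
    proof eventually_elim
      case (elim n)
      have "l < r powr p" if "0 \<le> r" "l powr (1 / p) < r" for r
        using powr_less_mono2[OF assms(1) _ that(2)] \<open>0 \<le> l\<close> assms(1) by (simp add: powr_powr)
      with elim \<open>0 \<le> l\<close> show ?case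
        by (cases "X n") (auto simp: ennreal_less_iff)
    qed
  qed
  then show ?thesis
    using top by (simp add: tendsto_top_iff_ennreal)
qed

section \<open>Rearrangement commutes with powers\<close>

lemma rearrangement_norm:
  "rearrangement M R (\<lambda>x. norm (f x)) = rearrangement M R f"
  by (simp add: rearrangement_def fun_eq_iff)

lemma rearrangement_indicator:
  assumes "A \<in> sets M" "y \<notin> R {}"
  shows "rearrangement M R (indicator A :: 'a \<Rightarrow> real) y = indicator (R A) y"
proof -
  have "{x \<in> space M. norm (indicator A x :: real) > t} = (if t < 1 then A else {})" if "0 < t" for t
    using that sets.sets_into_space[OF assms(1)] by (auto simp: indicator_def split: if_splits)
  then have "rearrangement M R (indicator A :: 'a \<Rightarrow> real) y
      = (\<integral>\<^sup>+ t. indicator (R A) y * indicator {0<..<1::real} t \<partial>lborel)"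
    unfolding rearrangement_def using assms(2)
    by (intro nn_integral_cong) (auto simp: indicator_def)
  then show ?thesis
    by (subst (asm) nn_integral_cmult) auto
qed

text \<open>The increasing sequence \<open>\<chi>\<^sub>A, \<chi>\<^sub>B, \<chi>\<^sub>B, \<dots>\<close> converges to \<open>\<chi>\<^sub>B\<close>, and the Fatou property forces the
  rearrangements \<open>\<chi>\<^bsub>R(A)\<^esub>, \<chi>\<^bsub>R(B)\<^esub>, \<dots>\<close> to increase as well.\<close>

lemma set_transformation_mono_AE:
  assumes st: "set_transformation M N R" and fat: "fatou_property M N R"
    and A: "A \<in> sets M" and B: "B \<in> sets M" and "A \<subseteq> B"
  shows "AE y in N. y \<in> R A \<longrightarrow> y \<in> R B"
proof -
  define F where "F n = (indicator (if n = 0 then A else B) :: 'a \<Rightarrow> real)" for n :: nat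
  have "AE y in N. incseq (\<lambda>n. rearrangement M R (F n) y) \<and>
      (\<lambda>n. rearrangement M R (F n) y) \<longlonglongrightarrow> rearrangement M R (indicator B :: 'a \<Rightarrow> real) y"
  proof (rule fat[unfolded fatou_property_def, rule_format])
    show "AE x in M. (\<lambda>n. F n x) \<longlonglongrightarrow> indicator B x"
    proof (intro AE_I2 tendsto_eventually)
      fix x show "\<forall>\<^sub>F n in sequentially. F n x = indicator B x"
        using eventually_gt_at_top[of "0::nat"] by eventually_elim (simp add: F_def)
    qed
    show "(\<forall>n. 0 \<le> F n x) \<and> incseq (\<lambda>n. F n x)" for x
      using \<open>A \<subseteq> B\<close> by (auto simp: F_def incseq_def indicator_def)
  qed (use A B in \<open>auto simp: F_def\<close>)
  moreover have "AE y in N. y \<notin> R {}"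
    using st by (intro AE_not_in) (auto simp: set_transformation_def null_sets_def)
  ultimately show ?thesis
  proof eventually_elim
    case (elim y)
    then have "rearrangement M R (F 0) y \<le> rearrangement M R (F 1) y"
      by (auto simp: incseq_def)
    with elim show ?case
      using A B by (simp add: F_def rearrangement_indicator indicator_def split: if_splits)
  qed
qed

lemma nn_integral_indicator_initial_segment:
  fixes T :: "real set"
  assumes "0 \<le> c" "\<And>t. 0 < t \<Longrightarrow> t < c \<Longrightarrow> t \<in> T" "\<And>t. 0 < t \<Longrightarrow> t \<in> T \<Longrightarrow> t \<le> c"
  shows "(\<integral>\<^sup>+ t\<in>{0<..}. indicator T t \<partial>lborel) = ennreal c"
proof -
  have "(\<integral>\<^sup>+ t\<in>{0<..}. indicator T t \<partial>lborel) = (\<integral>\<^sup>+ t. indicator {0<..<c} t \<partial>lborel)"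
  proof (rule nn_integral_cong_AE)
    show "AE t in lborel. indicator T t * indicator {0<..} t = (indicator {0<..<c} t :: ennreal)"
      using AE_lborel_singleton[of c]
    proof eventually_elim
      case (elim t)
      then show ?case
        using assms(2)[of t] assms(3)[of t] by (auto simp: indicator_def)
    qed
  qed
  then show ?thesis
    using assms(1) by simp
qed

text \<open>The reason why rearranging commutes with powers: a downward closed set of levels is an
  interval from \<open>0\<close> to some \<open>c \<le> \<infinity>\<close>, and relabelling the levels by \<open>t \<mapsto> t\<^sup>p\<close> moves its end
  point to \<open>c\<^sup>p\<close>.\<close>

lemma nn_integral_initial_segment_powr:
  fixes T :: "real set"
  assumes down: "\<And>s t. t \<in> T \<Longrightarrow> 0 < s \<Longrightarrow> s < t \<Longrightarrow> s \<in> T" and "0 < p"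
  shows "(\<integral>\<^sup>+ t\<in>{0<..}. indicator T (t powr (1 / p)) \<partial>lborel)
       = ennreal_powr (\<integral>\<^sup>+ t\<in>{0<..}. indicator T t \<partial>lborel) p"
proof (cases "bdd_above T")
  case True
  \<comment> \<open>Inserting \<open>0\<close> makes \<open>c\<close> the right end point also if \<open>T\<close> has no positive element.\<close>
  define c where "c = Sup (insert 0 T)"
  have le_c: "t \<le> c" if "t \<in> T" for t
    unfolding c_def using True that by (intro cSup_upper) auto
  have "0 \<le> c"
    unfolding c_def using True by (intro cSup_upper) auto
  have less_c: "t \<in> T" if t: "0 < t" "t < c" for t
  proof -
    obtain s where "s \<in> insert 0 T" "t < s"
      using t less_cSupD[of "insert 0 T" t] unfolding c_def by blast
    with \<open>0 < t\<close> show ?thesis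
      using down by auto
  qed
  have "(\<integral>\<^sup>+ t\<in>{0<..}. indicator {t. t powr (1 / p) \<in> T} t \<partial>lborel) = ennreal (c powr p)"
  proof (rule nn_integral_indicator_initial_segment)
    fix t :: real assume t: "0 < t" "t < c powr p"
    then have "t powr (1 / p) < (c powr p) powr (1 / p)"
      using \<open>0 < p\<close> by (intro powr_less_mono2) auto
    with t show "t \<in> {t. t powr (1 / p) \<in> T}"
      using \<open>0 < p\<close> \<open>0 \<le> c\<close> by (auto simp: powr_powr intro!: less_c)
  next
    fix t :: real assume t: "0 < t" "t \<in> {t. t powr (1 / p) \<in> T}"
    then have "(t powr (1 / p)) powr p \<le> c powr p"
      using \<open>0 < p\<close> by (intro powr_mono2 le_c) auto
    with t show "t \<le> c powr p"
      using \<open>0 < p\<close> by (simp add: powr_powr)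
  qed simp
  moreover have "(\<integral>\<^sup>+ t\<in>{0<..}. indicator T t \<partial>lborel) = ennreal c"
    by (rule nn_integral_indicator_initial_segment) (use \<open>0 \<le> c\<close> le_c less_c in auto)
  ultimately show ?thesis
    using \<open>0 \<le> c\<close> by (simp add: indicator_def)
next
  case False
  then have T: "t \<in> T" if "0 < t" for t
    using down[OF _ that] by (meson bdd_aboveI linorder_not_le)
  have "emeasure lborel {0::real<..} = top"
  proof (rule ccontr)
    assume "emeasure lborel {0::real<..} \<noteq> top"
    then obtain r where r: "emeasure lborel {0::real<..} = ennreal r" "0 \<le> r"
      by (cases "emeasure lborel {0::real<..}") auto
    have "emeasure lborel {0<..<r + 1} \<le> emeasure lborel {0::real<..}"
      by (intro emeasure_mono) auto
    with r show False
      by (simp del: ennreal_plus)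
  qed
  then have top: "(\<integral>\<^sup>+ t. indicator {0::real<..} t \<partial>lborel) = top"
    by simp
  have "(\<integral>\<^sup>+ t\<in>{0<..}. indicator T (t powr (1 / p)) \<partial>lborel) = (\<integral>\<^sup>+ t. indicator {0::real<..} t \<partial>lborel)"
    "(\<integral>\<^sup>+ t\<in>{0<..}. indicator T t \<partial>lborel) = (\<integral>\<^sup>+ t. indicator {0::real<..} t \<partial>lborel)"
    by (auto intro!: nn_integral_cong simp: indicator_def T)
  then show ?thesis
    by (simp only: top ennreal_powr_top)
qed

text \<open>With only countably many level sets, one null set takes care of the monotonicity of \<open>R\<close> on all
  pairs of them, and outside of it the set of levels \<open>t\<close> with \<open>y \<in> R {|u| > t}\<close> is downward closed.\<close>

lemma rearrangement_powr_countable_levels: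
  fixes u :: "'a \<Rightarrow> real"
  assumes st: "set_transformation M N R" and fat: "fatou_property M N R"
    and u [measurable]: "u \<in> borel_measurable M" and "0 < p"
    and cnt: "countable (range (\<lambda>t. {x \<in> space M. t < norm (u x)}))"
  shows "AE y in N. rearrangement M R (\<lambda>x. norm (u x) powr p) y = ennreal_powr (rearrangement M R u y) p"
proof -
  let ?L = "\<lambda>t. {x \<in> space M. t < norm (u x)}"
  have "AE y in N. \<forall>A\<in>range ?L. \<forall>B\<in>range ?L. A \<subseteq> B \<longrightarrow> y \<in> R A \<longrightarrow> y \<in> R B"
  proof (intro AE_ball_countable' cnt)
    fix A B assume "A \<in> range ?L" "B \<in> range ?L"
    then have "A \<in> sets M" "B \<in> sets M"
      by auto
    then show "AE y in N. A \<subseteq> B \<longrightarrow> y \<in> R A \<longrightarrow> y \<in> R B"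
      using set_transformation_mono_AE[OF st fat] by (cases "A \<subseteq> B") auto
  qed
  then show ?thesis
  proof eventually_elim
    case (elim y)
    define T where "T = {t. y \<in> R (?L t)}"
    have down: "s \<in> T" if "t \<in> T" "0 < s" "s < t" for s t
    proof -
      have "?L t \<subseteq> ?L s"
        using that by auto
      then show ?thesis
        using elim that unfolding T_def by blast
    qed
    have level: "{x \<in> space M. t < norm (norm (u x) powr p)} = ?L (t powr (1 / p))" if "0 < t" for t
    proof -
      have "t < a powr p \<longleftrightarrow> t powr (1 / p) < a" if "0 \<le> a" for a
      proof -
        have "t < a powr p \<longleftrightarrow> (t powr (1 / p)) powr p < a powr p"
          using \<open>0 < t\<close> \<open>0 < p\<close> by (simp add: powr_powr)
        also have "\<dots> \<longleftrightarrow> t powr (1 / p) < a"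
          using \<open>0 < p\<close> that by (meson not_le powr_ge_zero powr_less_mono2 powr_mono2 order_less_imp_le)
        finally show ?thesis .
      qed
      then show ?thesis
        by simp
    qed
    have "rearrangement M R (\<lambda>x. norm (u x) powr p) y
        = (\<integral>\<^sup>+ t\<in>{0<..}. indicator T (t powr (1 / p)) \<partial>lborel)"
      unfolding rearrangement_def
      by (intro nn_integral_cong) (simp add: indicator_def T_def level del: real_norm_def)
    also have "\<dots> = ennreal_powr (\<integral>\<^sup>+ t\<in>{0<..}. indicator T t \<partial>lborel) p"
      using down \<open>0 < p\<close> by (rule nn_integral_initial_segment_powr)
    also have "(\<integral>\<^sup>+ t\<in>{0<..}. indicator T t \<partial>lborel) = rearrangement M R u y"
      unfolding rearrangement_def by (simp add: T_def indicator_def)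
    finally show ?case .
  qed
qed

text \<open>Rounding down to multiples of \<open>2\<^sup>-\<^sup>n\<close> gives an increasing approximation by functions with
  countably many level sets.\<close>

definition dyadic_floor :: "nat \<Rightarrow> real \<Rightarrow> real" where
  "dyadic_floor n r = \<lfloor>2 ^ n * r\<rfloor> / 2 ^ n"

lemma dyadic_floor_nonneg: "0 \<le> r \<Longrightarrow> 0 \<le> dyadic_floor n r"
  by (simp add: dyadic_floor_def)

lemma borel_measurable_dyadic_floor [measurable]: "dyadic_floor n \<in> borel_measurable borel"
  unfolding dyadic_floor_def by measurable

lemma incseq_dyadic_floor: "incseq (\<lambda>n. dyadic_floor n r)"
proof (rule incseq_SucI)
  fix n
  have "2 * \<lfloor>2 ^ n * r\<rfloor> \<le> \<lfloor>2 ^ Suc n * r\<rfloor>"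
    by (simp add: le_floor_iff mult.assoc)
  then have "real_of_int (2 * \<lfloor>2 ^ n * r\<rfloor>) \<le> \<lfloor>2 ^ Suc n * r\<rfloor>"
    by (rule of_int_le_iff[THEN iffD2])
  then show "dyadic_floor n r \<le> dyadic_floor (Suc n) r"
    by (simp add: dyadic_floor_def field_simps)
qed

lemma dyadic_floor_tendsto: "(\<lambda>n. dyadic_floor n r) \<longlonglongrightarrow> r"
proof (rule tendsto_sandwich)
  have "(\<lambda>n. r - (1 / 2) ^ n) \<longlonglongrightarrow> r - 0"
    by (intro tendsto_intros LIMSEQ_power_zero) auto
  then show "(\<lambda>n. r - (1 / 2) ^ n) \<longlonglongrightarrow> r"
    by simp
  have "r - (1 / 2) ^ n \<le> dyadic_floor n r" for n
  proof -
    have "2 ^ n * r - 1 \<le> \<lfloor>2 ^ n * r\<rfloor>"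
      by linarith
    then have "(2 ^ n * r - 1) / 2 ^ n \<le> dyadic_floor n r"
      unfolding dyadic_floor_def by (rule divide_right_mono) simp
    then show ?thesis
      by (simp add: diff_divide_distrib power_one_over)
  qed
  then show "\<forall>\<^sub>F n in sequentially. r - (1 / 2) ^ n \<le> dyadic_floor n r"
    by simp
  have "dyadic_floor n r \<le> r" for n
    by (simp add: dyadic_floor_def field_simps)
  then show "\<forall>\<^sub>F n in sequentially. dyadic_floor n r \<le> r"
    by simp
qed simp

lemma countable_dyadic_floor_level_sets:
  "countable (range (\<lambda>t. {x \<in> S. t < dyadic_floor n (f x)}))"
proof (rule countable_subset)
  have "t < dyadic_floor n r \<longleftrightarrow> \<lfloor>2 ^ n * t\<rfloor> < \<lfloor>2 ^ n * r\<rfloor>" for t r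
    by (simp add: dyadic_floor_def floor_less_iff field_simps)
  then show "range (\<lambda>t. {x \<in> S. t < dyadic_floor n (f x)})
      \<subseteq> range (\<lambda>k. {x \<in> S. k < \<lfloor>2 ^ n * f x\<rfloor>})"
    by auto
qed simp

text \<open>For the dyadic approximations \<open>F\<^sub>n\<close> of \<open>|f|\<close> the identity is known. The Fatou property is used
  twice, for \<open>F\<^sub>n\<close> increasing to \<open>|f|\<close> and for \<open>F\<^sub>n\<^sup>p\<close> increasing to \<open>|f|\<^sup>p\<close>, so that both sides
  converge.\<close>

lemma rearrangement_powr:
  fixes f :: "'a \<Rightarrow> 'k::real_normed_vector"
  assumes st: "set_transformation M N R" and fat: "fatou_property M N R"
    and f [measurable]: "f \<in> borel_measurable M" and "0 < p"
  shows "AE y in N. rearrangement M R (\<lambda>x. norm (f x) powr p) y = ennreal_powr (rearrangement M R f y) p"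
proof -
  define F where "F n x = dyadic_floor n (norm (f x))" for n x
  have F_nonneg: "0 \<le> F n x" for n x
    by (simp add: F_def dyadic_floor_nonneg)
  have F_inc: "incseq (\<lambda>n. F n x)" for x
    unfolding F_def by (rule incseq_dyadic_floor)
  have F_lim: "(\<lambda>n. F n x) \<longlonglongrightarrow> norm (f x)" for x
    unfolding F_def by (rule dyadic_floor_tendsto)
  have F_meas [measurable]: "F n \<in> borel_measurable M" for n
    unfolding F_def by measurable
  have "AE y in N. incseq (\<lambda>n. rearrangement M R (F n) y) \<and>
      (\<lambda>n. rearrangement M R (F n) y) \<longlonglongrightarrow> rearrangement M R (\<lambda>x. norm (f x)) y"
    using F_nonneg F_inc F_lim
    by (intro fat[unfolded fatou_property_def, rule_format]) auto
  moreover have "AE y in N. incseq (\<lambda>n. rearrangement M R (\<lambda>x. norm (F n x) powr p) y) \<and>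
      (\<lambda>n. rearrangement M R (\<lambda>x. norm (F n x) powr p) y)
        \<longlonglongrightarrow> rearrangement M R (\<lambda>x. norm (f x) powr p) y"
  proof (intro fat[unfolded fatou_property_def, rule_format])
    show "AE x in M. (\<lambda>n. norm (F n x) powr p) \<longlonglongrightarrow> norm (f x) powr p"
      using F_lim F_nonneg \<open>0 < p\<close> by (intro AE_I2 tendsto_powr') auto
    show "(\<forall>n. 0 \<le> norm (F n x) powr p) \<and> incseq (\<lambda>n. norm (F n x) powr p)" for x
      using F_inc[of x] F_nonneg \<open>0 < p\<close> by (auto simp: incseq_def intro!: powr_mono2)
  qed auto
  moreover have "AE y in N. \<forall>n. rearrangement M R (\<lambda>x. norm (F n x) powr p) y
      = ennreal_powr (rearrangement M R (F n) y) p"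
  proof (subst AE_all_countable, intro allI rearrangement_powr_countable_levels[OF st fat F_meas \<open>0 < p\<close>])
    fix n
    show "countable (range (\<lambda>t. {x \<in> space M. t < norm (F n x)}))"
      using countable_dyadic_floor_level_sets[of "space M" n "\<lambda>x. norm (f x)"] F_nonneg
      by (simp add: F_def dyadic_floor_nonneg)
  qed
  ultimately show ?thesis
  proof eventually_elim
    case (elim y)
    then have "(\<lambda>n. rearrangement M R (\<lambda>x. norm (F n x) powr p) y)
        \<longlonglongrightarrow> ennreal_powr (rearrangement M R f y) p"
      using tendsto_ennreal_powr[OF \<open>0 < p\<close>] by (simp add: rearrangement_norm)
    with elim show ?case
      by (blast intro: LIMSEQ_unique)
  qed
qed

section \<open>Suprema of weighted \<open>L\<^sup>p\<close> seminorms\<close>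

text \<open>This is the \<open>p\<close>-th power of the supremum over \<open>h \<in> H\<close> of the norms of \<open>f\<close> in
  \<open>L\<^sup>p(|h| d\<mu>)\<close>. The functions \<open>f\<close> and \<open>h\<close> may take values in different spaces, so that indicator
  functions can be real-valued.\<close>

definition power_sup ::
    "'a measure \<Rightarrow> ('a \<Rightarrow> 'c::real_normed_vector) set \<Rightarrow> real \<Rightarrow> ('a \<Rightarrow> 'k::real_normed_vector) \<Rightarrow> ennreal"
  where "power_sup M H p f =
    (SUP h\<in>H. \<integral>\<^sup>+ x. ennreal (norm (f x) powr p * norm (h x)) \<partial>M)"

text \<open>Convexity of \<open>x \<mapsto> x\<^sup>p\<close>, applied to \<open>s / a\<close> and \<open>t / b\<close> with coefficients \<open>a / (a + b)\<close> and
  \<open>b / (a + b)\<close>. If \<open>s\<close> and \<open>t\<close> have \<open>p\<close>-th powers with integrals at most \<open>a\<^sup>p\<close> and \<open>b\<^sup>p\<close>, the right-hand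
  side integrates to at most \<open>(a + b)\<^sup>p\<close>, which is Minkowski's inequality.\<close>

lemma powr_add_le_convex:
  fixes a b s t :: real
  assumes "1 \<le> p" "0 < a" "0 < b" "0 \<le> s" "0 \<le> t"
  shows "(s + t) powr p \<le> (a + b) powr p *
    (a / (a + b) * (s powr p / a powr p) + b / (a + b) * (t powr p / b powr p))"
proof -
  \<comment> \<open>\<open>powr_convex\<close> covers the open half-line; the end point \<open>0\<close> follows from \<open>l\<^sup>p \<le> l\<close> for \<open>0 < l < 1\<close>.\<close>
  have *: "((1 - l) * x + l * y) powr p \<le> (1 - l) * x powr p + l * y powr p"
    if xyl: "0 \<le> x" "0 \<le> y" "0 < l" "l < 1" for x y l
  proof -
    have small: "c powr p \<le> c" if "0 < c" "c < 1" for c :: real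
      using powr_mono'[of 1 p c] assms(1) that by simp
    consider "0 < x" "0 < y" | "x = 0" | "y = 0"
      using xyl(1,2) by (metis order_le_less)
    then show ?thesis
    proof cases
      case 1
      then show ?thesis
        using convex_onD[OF powr_convex[OF assms(1)], of l x y] xyl by simp
    next
      case 2
      then show ?thesis
        using small[of l] xyl by (simp add: powr_mult mult_right_mono)
    next
      case 3
      then show ?thesis
        using small[of "1 - l"] xyl by (simp add: powr_mult mult_right_mono)
    qed
  qed
  have l: "1 - b / (a + b) = a / (a + b)"
    using assms by (simp add: field_simps)
  have "(a + b) * (a / (a + b) * (s / a)) = s" "(a + b) * (b / (a + b) * (t / b)) = t"
    using assms by simp_all
  then have "(s + t) powr p = ((a + b) * (a / (a + b) * (s / a) + b / (a + b) * (t / b))) powr p"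
    by (simp only: distrib_left)
  also have "\<dots> = (a + b) powr p * (a / (a + b) * (s / a) + b / (a + b) * (t / b)) powr p"
    by (rule powr_mult)
  also have "\<dots> \<le> (a + b) powr p * (a / (a + b) * (s / a) powr p + b / (a + b) * (t / b) powr p)"
  proof (rule mult_left_mono)
    have "0 \<le> s / a" "0 \<le> t / b" "0 < b / (a + b)" "b / (a + b) < 1"
      using assms by simp_all
    from *[OF this] show "(a / (a + b) * (s / a) + b / (a + b) * (t / b)) powr p
        \<le> a / (a + b) * (s / a) powr p + b / (a + b) * (t / b) powr p"
      by (simp only: l)
  qed simp
  finally show ?thesis
    using assms by (simp add: powr_divide)
qed

text \<open>Minkowski's inequality in unit-ball form. The bounds \<open>a\<close> and \<open>b\<close> do not depend on \<open>h\<close>, so the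
  inequality for each single weight \<open>|h|\<close> passes to the supremum at once.\<close>

lemma power_sup_add_le:
  fixes f g :: "'a \<Rightarrow> 'k::{real_normed_vector, second_countable_topology}"
    and H :: "('a \<Rightarrow> 'c::real_normed_vector) set"
  assumes H: "H \<subseteq> borel_measurable M" and "1 \<le> p"
    and [measurable]: "f \<in> borel_measurable M" "g \<in> borel_measurable M"
    and "0 < a" "0 < b"
    and f: "power_sup M H p f \<le> ennreal (a powr p)" and g: "power_sup M H p g \<le> ennreal (b powr p)"
  shows "power_sup M H p (\<lambda>x. f x + g x) \<le> ennreal ((a + b) powr p)"
  unfolding power_sup_def
proof (rule SUP_least)
  fix h assume "h \<in> H"
  then have [measurable]: "h \<in> borel_measurable M"
    using H by auto
  define \<alpha> \<beta> where "\<alpha> = (a + b) powr p * (a / (a + b)) / a powr p"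
    and "\<beta> = (a + b) powr p * (b / (a + b)) / b powr p"
  have nonneg: "0 \<le> \<alpha>" "0 \<le> \<beta>"
    using assms by (auto simp: \<alpha>_def \<beta>_def)
  have sum: "\<alpha> * a powr p + \<beta> * b powr p = (a + b) powr p"
  proof -
    have "\<alpha> * a powr p = (a + b) powr p * (a / (a + b))" "\<beta> * b powr p = (a + b) powr p * (b / (a + b))"
      using assms by (simp_all add: \<alpha>_def \<beta>_def)
    then have "\<alpha> * a powr p + \<beta> * b powr p = (a + b) powr p * (a / (a + b) + b / (a + b))"
      by (simp only: distrib_left)
    also have "a / (a + b) + b / (a + b) = 1"
      using assms by (simp add: add_divide_distrib[symmetric])
    finally show ?thesis
      by simp
  qed
  have fh: "(\<integral>\<^sup>+ x. ennreal (norm (f x) powr p * norm (h x)) \<partial>M) \<le> ennreal (a powr p)"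
    using f \<open>h \<in> H\<close> unfolding power_sup_def by (auto simp: SUP_le_iff)
  have gh: "(\<integral>\<^sup>+ x. ennreal (norm (g x) powr p * norm (h x)) \<partial>M) \<le> ennreal (b powr p)"
    using g \<open>h \<in> H\<close> unfolding power_sup_def by (auto simp: SUP_le_iff)
  have pointwise: "norm (f x + g x) powr p \<le> \<alpha> * norm (f x) powr p + \<beta> * norm (g x) powr p" for x
  proof -
    have "norm (f x + g x) powr p \<le> (norm (f x) + norm (g x)) powr p"
      using assms by (intro powr_mono2 norm_triangle_ineq) auto
    also have "\<dots> \<le> \<alpha> * norm (f x) powr p + \<beta> * norm (g x) powr p"
      using powr_add_le_convex[of p a b "norm (f x)" "norm (g x)"] assms
      by (simp add: \<alpha>_def \<beta>_def algebra_simps)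
    finally show ?thesis .
  qed
  have "(\<integral>\<^sup>+ x. ennreal (norm (f x + g x) powr p * norm (h x)) \<partial>M)
      \<le> (\<integral>\<^sup>+ x. ennreal \<alpha> * ennreal (norm (f x) powr p * norm (h x))
              + ennreal \<beta> * ennreal (norm (g x) powr p * norm (h x)) \<partial>M)"
  proof (rule nn_integral_mono)
    fix x
    have "norm (f x + g x) powr p * norm (h x)
        \<le> \<alpha> * (norm (f x) powr p * norm (h x)) + \<beta> * (norm (g x) powr p * norm (h x))"
      using mult_right_mono[OF pointwise[of x], of "norm (h x)"] by (simp add: algebra_simps)
    then show "ennreal (norm (f x + g x) powr p * norm (h x))
        \<le> ennreal \<alpha> * ennreal (norm (f x) powr p * norm (h x))
              + ennreal \<beta> * ennreal (norm (g x) powr p * norm (h x))"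
      using nonneg by (simp add: ennreal_mult[symmetric] ennreal_plus[symmetric] ennreal_leI del: ennreal_plus)
  qed
  also have "\<dots> = ennreal \<alpha> * (\<integral>\<^sup>+ x. ennreal (norm (f x) powr p * norm (h x)) \<partial>M)
      + ennreal \<beta> * (\<integral>\<^sup>+ x. ennreal (norm (g x) powr p * norm (h x)) \<partial>M)"
    by (simp add: nn_integral_add nn_integral_cmult)
  also have "\<dots> \<le> ennreal \<alpha> * ennreal (a powr p) + ennreal \<beta> * ennreal (b powr p)"
    by (intro add_mono mult_left_mono fh gh) auto
  also have "\<dots> = ennreal ((a + b) powr p)"
    using nonneg by (simp add: ennreal_mult[symmetric] ennreal_plus[symmetric] sum del: ennreal_plus)
  finally show "(\<integral>\<^sup>+ x. ennreal (norm (f x + g x) powr p * norm (h x)) \<partial>M) \<le> ennreal ((a + b) powr p)" .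
qed

lemma power_sup_cmult:
  fixes f :: "'a \<Rightarrow> 'k::real_normed_field"
    and H :: "('a \<Rightarrow> 'c::real_normed_vector) set"
  assumes H: "H \<subseteq> borel_measurable M" and [measurable]: "f \<in> borel_measurable M"
  shows "power_sup M H p (\<lambda>x. c * f x) = ennreal (norm c powr p) * power_sup M H p f"
  unfolding power_sup_def SUP_mult_left_ennreal
proof (rule SUP_cong)
  fix h assume "h \<in> H"
  then have [measurable]: "h \<in> borel_measurable M"
    using H by auto
  have "(\<integral>\<^sup>+ x. ennreal (norm (c * f x) powr p * norm (h x)) \<partial>M)
      = (\<integral>\<^sup>+ x. ennreal (norm c powr p) * ennreal (norm (f x) powr p * norm (h x)) \<partial>M)"
    by (intro nn_integral_cong) (simp add: norm_mult powr_mult ennreal_mult[symmetric] mult.assoc)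
  then show "(\<integral>\<^sup>+ x. ennreal (norm (c * f x) powr p * norm (h x)) \<partial>M)
      = ennreal (norm c powr p) * (\<integral>\<^sup>+ x. ennreal (norm (f x) powr p * norm (h x)) \<partial>M)"
    by (simp add: nn_integral_cmult)
qed simp

lemma power_sup_cong_AE:
  assumes "AE x in M. f x = g x"
  shows "power_sup M H p f = power_sup M H p g"
  unfolding power_sup_def
  by (intro SUP_cong refl nn_integral_cong_AE) (use assms in \<open>auto elim!: eventually_mono\<close>)

text \<open>The hypothesis says that no set of positive measure is a null set for all measures
  \<open>|h| d\<mu>\<close> at once. It is applied to the set where \<open>f\<close> is non-zero.\<close>

lemma power_sup_eq_0_iff:
  fixes f :: "'a \<Rightarrow> 'k::real_normed_vector"
    and H :: "('a \<Rightarrow> 'c::real_normed_vector) set"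
  assumes H: "H \<subseteq> borel_measurable M" and f [measurable]: "f \<in> borel_measurable M"
    and pos: "\<And>A. A \<in> sets M \<Longrightarrow> 0 < emeasure M A \<Longrightarrow> 0 < power_sup M H p (indicator A :: 'a \<Rightarrow> real)"
  shows "power_sup M H p f = 0 \<longleftrightarrow> (AE x in M. f x = 0)"
proof
  assume "AE x in M. f x = 0"
  then have "power_sup M H p f = power_sup M H p (\<lambda>x. 0 :: 'k)"
    by (rule power_sup_cong_AE)
  then show "power_sup M H p f = 0"
    by (simp add: power_sup_def SUP_constant bot_ennreal)
next
  assume zero: "power_sup M H p f = 0"
  define A where "A = {x \<in> space M. f x \<noteq> 0}"
  have A [measurable]: "A \<in> sets M"
    unfolding A_def by measurable
  have "power_sup M H p (indicator A :: 'a \<Rightarrow> real) \<le> 0"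
    unfolding power_sup_def
  proof (rule SUP_least)
    fix h assume "h \<in> H"
    then have [measurable]: "h \<in> borel_measurable M"
      using H by auto
    have "(\<integral>\<^sup>+ x. ennreal (norm (f x) powr p * norm (h x)) \<partial>M) \<le> 0"
      unfolding zero[symmetric] power_sup_def using \<open>h \<in> H\<close> by (rule SUP_upper)
    then have "(\<integral>\<^sup>+ x. ennreal (norm (f x) powr p * norm (h x)) \<partial>M) = 0"
      by simp
    then have "AE x in M. ennreal (norm (f x) powr p * norm (h x)) = 0"
      by (subst (asm) nn_integral_0_iff_AE) auto
    then have "AE x in M. ennreal (norm (indicator A x :: real) powr p * norm (h x)) = 0"
    proof (rule AE_mp, intro AE_I2 impI)
      fix x assume "ennreal (norm (f x) powr p * norm (h x)) = 0"
      then have "norm (f x) powr p * norm (h x) \<le> 0"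
        by (simp only: ennreal_eq_0_iff)
      then have "norm (f x) powr p * norm (h x) = 0"
        by (rule order_antisym) simp
      then show "ennreal (norm (indicator A x :: real) powr p * norm (h x)) = 0"
        by (auto simp: A_def indicator_def)
    qed
    then show "(\<integral>\<^sup>+ x. ennreal (norm (indicator A x :: real) powr p * norm (h x)) \<partial>M) \<le> 0"
      by (subst nn_integral_0_iff_AE[THEN iffD2]) auto
  qed
  then have "emeasure M A = 0"
    using pos[OF A] by (auto simp: not_less zero_less_iff_neq_zero)
  then show "AE x in M. f x = 0"
    using A by (subst AE_iff_measurable[of A]) (auto simp: A_def)
qed

lemma norm_modulo_AE_power_sup:
  fixes H :: "('a \<Rightarrow> 'c::real_normed_vector) set"
    and Q :: "('a \<Rightarrow> 'k::{real_normed_field, second_countable_topology}) \<Rightarrow> ennreal"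
  assumes H: "H \<subseteq> borel_measurable M" and "1 \<le> p"
    and pos: "\<And>A. A \<in> sets M \<Longrightarrow> 0 < emeasure M A \<Longrightarrow> 0 < power_sup M H p (indicator A :: 'a \<Rightarrow> real)"
    and Q: "\<And>f. f \<in> borel_measurable M \<Longrightarrow> Q f = ennreal_powr (power_sup M H p f) (1 / p)"
  shows "norm_modulo_AE M {f \<in> borel_measurable M. Q f < \<infinity>} (\<lambda>f. enn2real (Q f))"
proof -
  have "0 < p"
    using \<open>1 \<le> p\<close> by simp
  have Q_0_iff: "Q f = 0 \<longleftrightarrow> (AE x in M. f x = 0)" if "f \<in> borel_measurable M" for f
    using power_sup_eq_0_iff[OF H that pos] by (simp add: Q that)
  have Q_cong: "Q g = Q f" if "f \<in> borel_measurable M" "g \<in> borel_measurable M" "AE x in M. f x = g x" for f g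
    using power_sup_cong_AE[OF that(3), of H p] by (simp add: Q that)
  have Q_cmult: "Q (\<lambda>x. c * f x) = ennreal (norm c) * Q f" if [measurable]: "f \<in> borel_measurable M" for c f
    using ennreal_powr_root_mult[OF \<open>0 < p\<close>] by (simp add: Q power_sup_cmult[OF H])
  have Q_le_iff: "Q f \<le> ennreal c \<longleftrightarrow> power_sup M H p f \<le> ennreal (c powr p)"
    if "f \<in> borel_measurable M" "0 \<le> c" for f c
    using ennreal_powr_root_le_iff[OF \<open>0 < p\<close> that(2)] by (simp add: Q that)
  have Q_add: "Q (\<lambda>x. f x + g x) \<le> ennreal (enn2real (Q f) + enn2real (Q g))"
    if fg [measurable]: "f \<in> borel_measurable M" "g \<in> borel_measurable M" and fin: "Q f < \<infinity>" "Q g < \<infinity>" for f g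
  proof (rule ennreal_le_epsilon)
    fix e :: real assume "0 < e"
    \<comment> \<open>The surplus \<open>e\<close> makes both bounds positive, as the convexity argument divides by them.\<close>
    define a b where "a = enn2real (Q f) + e / 2" and "b = enn2real (Q g) + e / 2"
    have ab: "0 < a" "0 < b"
      using \<open>0 < e\<close> by (auto simp: a_def b_def add_nonneg_pos)
    have "Q f \<le> ennreal a" "Q g \<le> ennreal b"
      using fin \<open>0 < e\<close> by (cases "Q f"; cases "Q g"; auto simp: a_def b_def intro: ennreal_leI)+
    then have "Q (\<lambda>x. f x + g x) \<le> ennreal (a + b)"
      using power_sup_add_le[OF H \<open>1 \<le> p\<close> fg ab] ab by (simp add: Q_le_iff del: ennreal_plus)
    then show "Q (\<lambda>x. f x + g x) \<le> ennreal (enn2real (Q f) + enn2real (Q g)) + ennreal e"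
      using \<open>0 < e\<close> by (simp add: a_def b_def ennreal_plus[symmetric] add_ac del: ennreal_plus)
  qed
  show ?thesis
    unfolding norm_modulo_AE_def
  proof (intro conjI ballI allI impI)
    show "(\<lambda>x. 0) \<in> {f \<in> borel_measurable M. Q f < \<infinity>}"
      using Q_0_iff[of "\<lambda>x. 0"] by simp
  next
    fix f g assume "f \<in> {f \<in> borel_measurable M. Q f < \<infinity>}" "g \<in> {f \<in> borel_measurable M. Q f < \<infinity>}"
    then have fg: "f \<in> borel_measurable M" "g \<in> borel_measurable M" "Q f < \<infinity>" "Q g < \<infinity>"
      by auto
    show "(\<lambda>x. f x + g x) \<in> {f \<in> borel_measurable M. Q f < \<infinity>}"
      using fg Q_add[OF fg] by (auto intro: le_less_trans)
    show "enn2real (Q (\<lambda>x. f x + g x)) \<le> enn2real (Q f) + enn2real (Q g)"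
      using Q_add[OF fg] by (intro enn2real_leI) auto
  next
    fix f c assume "f \<in> {f \<in> borel_measurable M. Q f < \<infinity>}"
    then show "(\<lambda>x. c * f x) \<in> {f \<in> borel_measurable M. Q f < \<infinity>}"
      by (auto simp: Q_cmult ennreal_mult_less_top)
    show "enn2real (Q (\<lambda>x. c * f x)) = norm c * enn2real (Q f)"
      using \<open>f \<in> _\<close> by (simp add: Q_cmult enn2real_mult)
  next
    fix f assume "f \<in> {f \<in> borel_measurable M. Q f < \<infinity>}"
    then show "enn2real (Q f) = 0 \<longleftrightarrow> (AE x in M. f x = 0)"
      using Q_0_iff[of f] by (auto simp: enn2real_eq_0_iff)
  next
    fix f g assume "f \<in> {f \<in> borel_measurable M. Q f < \<infinity>}" "g \<in> borel_measurable M"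
      "AE x in M. f x = g x"
    moreover from this have "Q g = Q f"
      by (intro Q_cong) simp_all
    ultimately show "g \<in> {f \<in> borel_measurable M. Q f < \<infinity>}" "enn2real (Q g) = enn2real (Q f)"
      by simp_all
  qed auto
qed

section \<open>The Lorentz functional as a supremum of weighted \<open>L\<^sup>p\<close> seminorms\<close>

theorem theorem3p4:
  fixes M :: "'a measure" and N :: "'b measure" and R :: "'a set \<Rightarrow> 'b set"
    and p :: real and v :: "'b \<Rightarrow> real"
  assumes "sigma_finite_measure M" and "sigma_finite_measure N"
    and "set_transformation M N R" and "fatou_property M N R"
    and "1 \<le> p"
    and "weight M N R v"
    and "\<exists>h :: 'a \<Rightarrow> 'k::{real_normed_field, second_countable_topology}.
           h \<in> borel_measurable M \<and> (AE y in N. rearrangement M R h y = ennreal (v y))"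
    and "\<And>f :: 'a \<Rightarrow> 'k. f \<in> borel_measurable M \<Longrightarrow>
           (SUP h \<in> {h :: 'a \<Rightarrow> 'k. h \<in> borel_measurable M \<and>
                       (AE y in N. rearrangement M R h y = ennreal (v y))}.
              \<integral>\<^sup>+ x. ennreal (norm (f x * h x)) \<partial>M)
           = (\<integral>\<^sup>+ y. rearrangement M R f y * ennreal (v y) \<partial>N)"
  shows "norm_modulo_AE M (lorentz_space M N R p v :: ('a \<Rightarrow> 'k) set)
           (\<lambda>f. enn2real (lorentz_norm M N R p v f))"
proof -
  define H where "H = {h :: 'a \<Rightarrow> 'k. h \<in> borel_measurable M \<and>
    (AE y in N. rearrangement M R h y = ennreal (v y))}"
  have "0 < p"
    using \<open>1 \<le> p\<close> by simp
  have duality: "(\<integral>\<^sup>+ y. ennreal_powr (rearrangement M R f y) p * ennreal (v y) \<partial>N) = power_sup M H p f"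
    if f [measurable]: "f \<in> borel_measurable M" for f :: "'a \<Rightarrow> 'c::real_normed_vector"
  proof -
    \<comment> \<open>The duality formula speaks of functions with values in the scalar field, so \<open>|f|\<^sup>p\<close> is embedded there.\<close>
    let ?g = "\<lambda>x. of_real (norm (f x) powr p) :: 'k"
    have "rearrangement M R (\<lambda>x. norm (f x) powr p) = rearrangement M R ?g"
      by (simp add: rearrangement_def fun_eq_iff)
    then have "(\<integral>\<^sup>+ y. ennreal_powr (rearrangement M R f y) p * ennreal (v y) \<partial>N)
        = (\<integral>\<^sup>+ y. rearrangement M R ?g y * ennreal (v y) \<partial>N)"
      using rearrangement_powr[OF assms(3,4) f \<open>0 < p\<close>]
      by (intro nn_integral_cong_AE) (auto elim!: eventually_mono)
    also have "\<dots> = (SUP h\<in>H. \<integral>\<^sup>+ x. ennreal (norm (?g x * h x)) \<partial>M)"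
      unfolding H_def by (rule assms(8)[symmetric]) measurable
    also have "\<dots> = power_sup M H p f"
      by (simp add: power_sup_def norm_mult)
    finally show ?thesis .
  qed
  have pos: "0 < power_sup M H p (indicator A :: 'a \<Rightarrow> real)" if A: "A \<in> sets M" "0 < emeasure M A" for A
  proof -
    have "AE y in N. y \<notin> R {}"
      using assms(3) by (intro AE_not_in) (auto simp: set_transformation_def null_sets_def)
    then have "(\<integral>\<^sup>+ y. ennreal_powr (rearrangement M R (indicator A :: 'a \<Rightarrow> real) y) p * ennreal (v y) \<partial>N)
        = (\<integral>\<^sup>+ y\<in>R A. ennreal (v y) \<partial>N)"
    proof (intro nn_integral_cong_AE, eventually_elim)
      case (elim y)
      then show ?case
        using A ennreal_powr_ennreal[of 1 p] by (simp add: rearrangement_indicator indicator_def)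
    qed
    then show ?thesis
      using assms(6) A duality[of "indicator A :: 'a \<Rightarrow> real"] by (simp add: weight_def)
  qed
  show ?thesis
    unfolding lorentz_space_def
    by (rule norm_modulo_AE_power_sup[where H = H and p = p])
      (use \<open>1 \<le> p\<close> pos in \<open>auto simp: H_def[symmetric] lorentz_norm_def duality, auto simp: H_def\<close>)
qed

end
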